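(* Let $K$ be a symmetric convex body in $\mathbb{R}^n$. Then the following are equivalent: (i) for some $\tau>0$ the function $x\mapsto |K\cap(x+\tau K)|$ on $\mathbb{R}^n$ depends on $\|x\|_K$ only, i.e. $|K\cap (x+\tau K)|=|K\cap (y+\tau K)|$ whenever $x,y\in\mathbb{R}^n$ satisfy $\|x\|_K=\|y\|_K$; (ii) $K$ is an ellipsoid.
   Context: A convex body in $\mathbb{R}^n$ is a compact convex set with non-empty interior; symmetric means $K=-K$ (centrally symmetric about the origin). $\|x\|_K=\inf\{\lambda>0: x\in\lambda K\}$ is the norm with unit ball $K$. $|A|$ denotes the $n$-dimensional Lebesgue measure of $A\subset\mathbb{R}^n$. An ellipsoid here is centered at the origin, i.e. the image of the Euclidean unit ball under an invertible linear map. *)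

theory Defs
  imports "HOL-Analysis.Analysis"
begin

definition convex_body :: "'a::euclidean_space set \<Rightarrow> bool" where
  "convex_body K \<longleftrightarrow> compact K \<and> convex K \<and> interior K \<noteq> {}"

definition symmetric_body :: "'a::euclidean_space set \<Rightarrow> bool" where
  "symmetric_body K \<longleftrightarrow> convex_body K \<and> K = uminus ` K"

text \<open>The infimum is only meaningful when some positive multiple of \<open>K\<close> contains \<open>x\<close>,
  which holds for every \<open>x\<close> when \<open>K\<close> is a symmetric convex body.\<close>

definition body_norm :: "'a::euclidean_space set \<Rightarrow> 'a \<Rightarrow> real" where
  "body_norm K x = Inf {l. l > 0 \<and> x \<in> (\<lambda>y. l *\<^sub>R y) ` K}"

text \<open>Ellipsoids are centred at the origin and nondegenerate.\<close>

definition ellipsoid :: "'a::euclidean_space set \<Rightarrow> bool" where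
  "ellipsoid E \<longleftrightarrow> (\<exists>f::'a \<Rightarrow> 'a. linear f \<and> bij f \<and> E = f ` cball 0 1)"

definition overlap_volume :: "'a::euclidean_space set \<Rightarrow> real \<Rightarrow> 'a \<Rightarrow> real" where
  "overlap_volume K \<tau> x = measure lebesgue (K \<inter> (\<lambda>y. x + \<tau> *\<^sub>R y) ` K)"

end

theory Submission
  imports Defs
begin

text \<open>
  Suppose that \<open>|K \<inter> (x + \<tau>K)|\<close>, the convolution of the indicators of \<open>K\<close> and \<open>\<tau>K\<close>, is a function
  of the norm of \<open>x\<close>. Integrate it against \<open>(x \<bullet> \<xi>)\<^sup>m\<close> with \<open>m\<close> even, and let \<open>M\<^sub>m(\<xi>)\<close> be the integral
  of \<open>(x \<bullet> \<xi>)\<^sup>m\<close> over \<open>K\<close>. By homogeneity the result is \<open>c\<^sub>m M\<^sub>m(\<xi>)\<close> with \<open>c\<^sub>m\<close> independent of \<open>\<xi>\<close>;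
  by Fubini it is \<open>\<tau>\<^sup>n\<close> times the sum of the \<open>(m choose k) \<tau>\<^sup>m\<^sup>-\<^sup>k M\<^sub>k(\<xi>) M\<^sub>m\<^sub>-\<^sub>k(\<xi>)\<close>. For \<open>m > 2\<close> the terms with
  \<open>0 < k < m\<close> have a positive sum, so the resulting equation determines \<open>M\<^sub>m(\<xi>)\<close> from the lower
  moments, and inductively from \<open>M\<^sub>2(\<xi>)\<close>. The even moments determine the support function, which
  is therefore a multiple of the square root of the quadratic form \<open>M\<^sub>2\<close>: \<open>K\<close> is an ellipsoid.

  Conversely, a linear map that preserves \<open>K\<close> preserves volume, and for an ellipsoid such maps act
  transitively on the spheres of the norm.
\<close>

section \<open>Symmetric convex bodies and the norm they define\<close>

lemma symmetric_bodyD: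
  assumes "symmetric_body K"
  shows "compact K" "convex K" "K \<in> sets borel" "- x \<in> K \<longleftrightarrow> x \<in> K"
proof -
  show "compact K" "convex K" using assms by (auto simp: symmetric_body_def convex_body_def)
  then show "K \<in> sets borel" by (auto intro: borel_closed compact_imp_closed)
  have "K = uminus ` K" using assms by (auto simp: symmetric_body_def)
  then show "- x \<in> K \<longleftrightarrow> x \<in> K" by (metis image_iff minus_minus)
qed

text \<open>Some ball around a point \<open>a\<close> lies in \<open>K\<close>; averaging it with
  its reflection in the origin moves the centre to 0.\<close>

lemma symmetric_body_contains_ball:
  assumes "symmetric_body K"
  obtains e where "e > 0" "cball 0 e \<subseteq> K"
proof -
  have "interior K \<noteq> {}" using assms by (auto simp: symmetric_body_def convex_body_def)
  then obtain a e where e: "e > 0" "cball a e \<subseteq> K"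
    by (meson equals0I mem_interior_cball)
  have "cball 0 e \<subseteq> K"
  proof
    fix x :: 'a assume "x \<in> cball 0 e"
    then have "a + x \<in> K" "a - x \<in> K" using e by (auto simp: dist_norm subset_iff)
    then have "a + x \<in> K" "x - a \<in> K"
      using symmetric_bodyD(4)[OF assms, of "a - x"] by auto
    then have "(1/2) *\<^sub>R (a + x) + (1/2) *\<^sub>R (x - a) \<in> K"
      using symmetric_bodyD(2)[OF assms] by (intro convexD) auto
    then show "x \<in> K" by (simp add: algebra_simps flip: scaleR_add_left)
  qed
  with e that show thesis by blast
qed

lemma symmetric_body_zero_mem:
  assumes "symmetric_body K" shows "0 \<in> K"
  using symmetric_body_contains_ball[OF assms] by (metis centre_in_cball less_imp_le subsetD)

text \<open>The point lies on the segment from \<open>- x\<close> to \<open>x\<close>, with weights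
  \<open>(1 - c)/2\<close> and \<open>(1 + c)/2\<close>.\<close>

lemma symmetric_body_scaleR_mem:
  assumes "symmetric_body K" "x \<in> K" "\<bar>c\<bar> \<le> 1"
  shows "c *\<^sub>R x \<in> K"
proof -
  have "- x \<in> K" using assms symmetric_bodyD(4) by blast
  then have "((1 + c)/2) *\<^sub>R x + ((1 - c)/2) *\<^sub>R (- x) \<in> K"
    using assms symmetric_bodyD(2)[OF assms(1)] by (intro convexD) (auto simp: field_simps)
  moreover have "((1 + c)/2) *\<^sub>R x + ((1 - c)/2) *\<^sub>R (- x) = c *\<^sub>R x"
    by (simp add: algebra_simps flip: scaleR_add_left scaleR_diff_left scaleR_minus_left)
      (simp add: field_simps flip: scaleR_add_left scaleR_diff_left)
  ultimately show ?thesis by simp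
qed

text \<open>The infimum is attained because \<open>K\<close> is closed: \<open>K\<close> contains
  \<open>x /\<^sub>R s\<close> for all \<open>s > r\<close>, and s tends to r. At
  \<open>r = 0\<close> the equivalence would break down, since \<open>x /\<^sub>R 0 = 0\<close>
  always lies in \<open>K\<close>.\<close>

lemma body_norm_le_iff:
  assumes K: "symmetric_body K" and r: "r > 0"
  shows "body_norm K x \<le> r \<longleftrightarrow> x /\<^sub>R r \<in> K"
proof -
  let ?S = "{l. l > 0 \<and> x \<in> (\<lambda>y. l *\<^sub>R y) ` K}"
  have S: "?S = {l. l > 0 \<and> x /\<^sub>R l \<in> K}"
    by (auto simp: image_iff) (metis divideR_right less_irrefl)
  have bdd: "bdd_below ?S" by (auto intro: bdd_belowI[of _ 0])
  show ?thesis
  proof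
    assume "x /\<^sub>R r \<in> K"
    then show "body_norm K x \<le> r"
      unfolding body_norm_def using r S by (intro cInf_lower bdd) auto
  next
    assume le: "body_norm K x \<le> r"
    obtain e where e: "e > 0" "cball 0 e \<subseteq> K" using symmetric_body_contains_ball[OF K] .
    \<comment> \<open>Dilating by \<open>b\<close> puts \<open>x\<close> into the dilated ball of
      radius \<open>e\<close>, so the infimum is over a nonempty set. The summand 1 keeps
      \<open>b\<close> positive at \<open>x = 0\<close>.\<close>
    define b where "b = (norm x + 1) / e"
    have b: "b > 0" "norm x \<le> e * b" using e by (auto simp: b_def add_nonneg_pos)
    have "norm (x /\<^sub>R b) \<le> e"
      using b by (simp add: inverse_eq_divide divide_le_eq)
    then have "b \<in> ?S" unfolding S using e b by (auto simp: subset_iff)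
    then have ne: "?S \<noteq> {}" by blast
    have *: "x /\<^sub>R s \<in> K" if "s > r" for s
    proof -
      have "body_norm K x < s" using le that by simp
      then obtain l where l: "l > 0" "x /\<^sub>R l \<in> K" "l < s"
        unfolding body_norm_def using cInf_less_iff[OF ne bdd] S by blast
      have "(l / s) *\<^sub>R (x /\<^sub>R l) \<in> K"
        by (rule symmetric_body_scaleR_mem[OF K l(2)]) (use l in simp)
      moreover have "(l / s) *\<^sub>R (x /\<^sub>R l) = x /\<^sub>R s"
        using l(1) by (simp add: divide_inverse)
      ultimately show ?thesis by metis
    qed
    have in_K: "x /\<^sub>R (r + 1 / Suc n) \<in> K" for n by (rule *) simp
    have lim: "(\<lambda>n. x /\<^sub>R (r + 1 / Suc n)) \<longlonglongrightarrow> x /\<^sub>R (r + 0)"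
      using r by (intro tendsto_intros LIMSEQ_Suc lim_const_over_n) auto
    have "closed K" by (rule compact_imp_closed[OF symmetric_bodyD(1)[OF K]])
    from closed_sequentially[OF this in_K lim] show "x /\<^sub>R r \<in> K" by simp
  qed
qed

lemma body_norm_nonneg:
  assumes K: "symmetric_body K"
  shows "body_norm K x \<ge> 0"
proof (rule ccontr)
  let ?S = "{l. l > 0 \<and> x \<in> (\<lambda>y. l *\<^sub>R y) ` K}"
  assume "\<not> ?thesis"
  then have neg: "body_norm K x < 0" by simp
  \<comment> \<open>The value of \<open>Inf {}\<close> is of no use, so nonemptiness comes first: a
    negative norm is at most 1, which makes 1 an element of the set.\<close>
  then have "x /\<^sub>R 1 \<in> K" using body_norm_le_iff[OF K, of 1 x] by simp
  then have "?S \<noteq> {}" by (auto intro!: exI[of _ 1])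
  then have "0 \<le> Inf ?S" by (rule cInf_greatest) auto
  with neg show False by (simp add: body_norm_def)
qed

text \<open>Positive thresholds suffice, as a nonnegative number is determined by the positive
  numbers that are not below it.\<close>

lemma body_norm_eqI:
  assumes K: "symmetric_body K" and a: "a \<ge> 0"
    and "\<And>r. r > 0 \<Longrightarrow> x /\<^sub>R r \<in> K \<longleftrightarrow> a \<le> r"
  shows "body_norm K x = a"
proof -
  have *: "body_norm K x \<le> r \<longleftrightarrow> a \<le> r" if "r > 0" for r
    using assms(3)[OF that] body_norm_le_iff[OF K that] by blast
  show ?thesis
  proof (rule antisym)
    show "body_norm K x \<le> a"
    proof (rule field_le_epsilon)
      fix d :: real assume "d > 0"
      then show "body_norm K x \<le> a + d" using * a by simp
    qed
    show "a \<le> body_norm K x"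
    proof (rule field_le_epsilon)
      fix d :: real assume "d > 0"
      then show "a \<le> body_norm K x + d" using *[of "body_norm K x + d"] body_norm_nonneg[OF K, of x] by simp
    qed
  qed
qed

lemma body_norm_scaleR:
  assumes K: "symmetric_body K" and c: "c > 0"
  shows "body_norm K (c *\<^sub>R x) = c * body_norm K x"
proof (rule body_norm_eqI[OF K])
  show "0 \<le> c * body_norm K x" using c body_norm_nonneg[OF K] by auto
  fix r :: real assume "r > 0"
  then have "body_norm K x \<le> r / c \<longleftrightarrow> x /\<^sub>R (r / c) \<in> K"
    using c by (intro body_norm_le_iff[OF K]) auto
  moreover have "(c *\<^sub>R x) /\<^sub>R r = x /\<^sub>R (r / c)" using c by (simp add: divide_inverse mult.commute)
  moreover have "body_norm K x \<le> r / c \<longleftrightarrow> c * body_norm K x \<le> r" using c by (simp add: le_divide_eq mult.commute)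
  ultimately show "(c *\<^sub>R x) /\<^sub>R r \<in> K \<longleftrightarrow> c * body_norm K x \<le> r" by metis
qed

lemma body_norm_pos:
  assumes K: "symmetric_body K" and x: "x \<noteq> 0"
  shows "body_norm K x > 0"
proof (rule ccontr)
  assume "\<not> ?thesis"
  then have "body_norm K x \<le> 0" by simp
  then have *: "x /\<^sub>R r \<in> K" if "r > 0" for r using that body_norm_le_iff[OF K that, of x] by simp
  obtain B where B: "B > 0" "\<And>y. y \<in> K \<Longrightarrow> norm y \<le> B"
    using compact_imp_bounded[OF symmetric_bodyD(1)[OF K]] bounded_pos by blast
  \<comment> \<open>This multiple of \<open>x\<close> has Euclidean norm \<open>2 * B\<close>,
    beyond the bound \<open>B\<close> on \<open>K\<close>.\<close>
  have "x /\<^sub>R (norm x / (2 * B)) \<in> K" using x B(1) by (intro *) simp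
  then have "norm (x /\<^sub>R (norm x / (2 * B))) \<le> B" by (rule B(2))
  moreover have "norm (x /\<^sub>R (norm x / (2 * B))) = 2 * B" using x B(1) by simp
  ultimately show False using B(1) by linarith
qed

lemma body_norm_zero:
  assumes K: "symmetric_body K" shows "body_norm K 0 = 0"
  using symmetric_body_zero_mem[OF K] by (intro body_norm_eqI[OF K]) auto

text \<open>A ray on which the norm takes each value once; a function of the norm can be read off
  along it.\<close>

lemma body_norm_unit_vector:
  fixes K :: "'a::euclidean_space set"
  assumes K: "symmetric_body K"
  obtains e where "\<And>r. r \<ge> 0 \<Longrightarrow> body_norm K (r *\<^sub>R e) = r"
proof -
  obtain x :: 'a where "x \<in> Basis" using nonempty_Basis by blast
  then have p: "body_norm K x > 0" using body_norm_pos[OF K] nonzero_Basis by blast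
  show thesis
  proof (rule that[of "x /\<^sub>R body_norm K x"])
    fix r :: real assume "r \<ge> 0"
    show "body_norm K (r *\<^sub>R (x /\<^sub>R body_norm K x)) = r"
    proof (cases "r = 0")
      case False
      have "body_norm K ((r / body_norm K x) *\<^sub>R x) = r / body_norm K x * body_norm K x"
        using False \<open>r \<ge> 0\<close> p by (intro body_norm_scaleR[OF K]) simp
      then show ?thesis using p by (simp add: divide_inverse)
    qed (simp add: body_norm_zero[OF K])
  qed
qed

lemma borel_measurable_body_norm:
  assumes K: "symmetric_body K"
  shows "body_norm K \<in> borel_measurable borel"
proof (rule borel_measurableI_le)
  fix r
  show "{x \<in> space borel. body_norm K x \<le> r} \<in> sets borel"
  proof (cases "r > 0")
    case True
    have "{x. x /\<^sub>R r \<in> K} = (\<lambda>x. x /\<^sub>R r) -` K \<inter> space borel" by auto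
    also have "\<dots> \<in> sets borel"
      using symmetric_bodyD(3)[OF K] by (intro measurable_sets[of _ _ borel]) simp_all
    finally show ?thesis using body_norm_le_iff[OF K True] by simp
  next
    case False
    have "{x. body_norm K x \<le> r} \<subseteq> {0}"
    proof
      fix x assume "x \<in> {x. body_norm K x \<le> r}"
      then have "\<not> body_norm K x > 0" using False by simp
      then show "x \<in> {0}" using body_norm_pos[OF K, of x] by blast
    qed
    then have "finite {x. body_norm K x \<le> r}" by (rule finite_subset) simp
    then have "closed {x. body_norm K x \<le> r}" by (rule finite_imp_closed)
    then show ?thesis by (simp add: borel_closed)
  qed
qed

section \<open>Homogeneous densities and integrals of functions of the norm\<close>

lemma nn_integral_lborel_affine:
  fixes f :: "'a::euclidean_space \<Rightarrow> ennreal"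
  assumes c: "c \<noteq> 0" and [measurable]: "f \<in> borel_measurable borel"
  shows "(\<integral>\<^sup>+x. f x \<partial>lborel) = ennreal (\<bar>c\<bar> ^ DIM('a)) * (\<integral>\<^sup>+x. f (t + c *\<^sub>R x) \<partial>lborel)"
  by (subst lborel_affine[OF c, of t])
    (simp add: nn_integral_density nn_integral_distr nn_integral_cmult)

text \<open>Homogeneity determines the image of the measure \<open>p dx\<close> under \<open>body_norm K\<close> up to a factor.\<close>

lemma nn_integral_body_norm_homogeneous_eq:
  fixes p q :: "'a::euclidean_space \<Rightarrow> ennreal"
  assumes K: "symmetric_body K"
    and [measurable]: "p \<in> borel_measurable borel" "q \<in> borel_measurable borel" "g \<in> borel_measurable borel"
    and hp: "\<And>c x. c > 0 \<Longrightarrow> p (c *\<^sub>R x) = ennreal (c ^ m) * p x"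
    and hq: "\<And>c x. c > 0 \<Longrightarrow> q (c *\<^sub>R x) = ennreal (c ^ m) * q x"
    and eq: "(\<integral>\<^sup>+x. indicator K x * p x \<partial>lborel) = (\<integral>\<^sup>+x. indicator K x * q x \<partial>lborel)"
    and fin: "(\<integral>\<^sup>+x. indicator K x * p x \<partial>lborel) < \<infinity>"
  shows "(\<integral>\<^sup>+x. g (body_norm K x) * p x \<partial>lborel) = (\<integral>\<^sup>+x. g (body_norm K x) * q x \<partial>lborel)"
proof -
  note [measurable] = borel_measurable_body_norm[OF K] symmetric_bodyD(3)[OF K]
  define D where "D p = distr (density lborel p) borel (body_norm K)" for p
  have D: "emeasure (D p) {..r} = (\<integral>\<^sup>+x. indicator {..r} (body_norm K x) * p x \<partial>lborel)"
    if [measurable]: "p \<in> borel_measurable borel" for p r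
  proof -
    have "emeasure (D p) {..r} = (\<integral>\<^sup>+x. indicator {..r} x \<partial>D p)"
      by (simp add: D_def)
    also have "\<dots> = (\<integral>\<^sup>+x. p x * indicator {..r} (body_norm K x) \<partial>lborel)"
      unfolding D_def by (subst nn_integral_distr, simp, simp, subst nn_integral_density) simp_all
    finally show ?thesis by (simp add: mult.commute)
  qed
  \<comment> \<open>The norm is positive off the origin, and the origin is a null set.\<close>
  have em0: "emeasure (D p) {..r} = 0" if "r \<le> 0" and [measurable]: "p \<in> borel_measurable borel" for p r
  proof -
    have "AE x::'a in lborel. x \<noteq> 0" by (rule AE_lborel_singleton)
    then have "AE x in lborel. indicator {..r} (body_norm K x) * p x = 0"
    proof eventually_elim
      case (elim x)
      then show ?case using body_norm_pos[OF K elim] \<open>r \<le> 0\<close> by simp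
    qed
    then show ?thesis by (simp add: D nn_integral_0_iff_AE)
  qed
  \<comment> \<open>Substituting \<open>r *\<^sub>R x\<close> for \<open>x\<close> turns the
    sublevel set into \<open>K\<close>; the Jacobian contributes the exponent
    \<open>DIM('a)\<close>, homogeneity the exponent \<open>m\<close>.\<close>
  have em: "emeasure (D p) {..r} = ennreal (r ^ (DIM('a) + m)) * (\<integral>\<^sup>+x. indicator K x * p x \<partial>lborel)"
    if r: "r > 0" and [measurable]: "p \<in> borel_measurable borel"
      and h: "\<And>c x. c > 0 \<Longrightarrow> p (c *\<^sub>R x) = ennreal (c ^ m) * p x" for p r
  proof -
    have "emeasure (D p) {..r} = (\<integral>\<^sup>+x. indicator {..r} (body_norm K x) * p x \<partial>lborel)"
      by (rule D) measurable
    also have "\<dots> = (\<integral>\<^sup>+x. indicator K (x /\<^sub>R r) * p x \<partial>lborel)"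
      using body_norm_le_iff[OF K r] by (auto simp: indicator_def intro!: nn_integral_cong)
    also have "\<dots> = ennreal (\<bar>r\<bar> ^ DIM('a)) *
        (\<integral>\<^sup>+x. indicator K ((0 + r *\<^sub>R x) /\<^sub>R r) * p (0 + r *\<^sub>R x) \<partial>lborel)"
      using r by (intro nn_integral_lborel_affine) auto
    also have "(\<integral>\<^sup>+x. indicator K ((0 + r *\<^sub>R x) /\<^sub>R r) * p (0 + r *\<^sub>R x) \<partial>lborel)
        = (\<integral>\<^sup>+x. ennreal (r ^ m) * (indicator K x * p x) \<partial>lborel)"
      using r h by (intro nn_integral_cong) (simp add: mult_ac)
    also have "\<dots> = ennreal (r ^ m) * (\<integral>\<^sup>+x. indicator K x * p x \<partial>lborel)"
      by (rule nn_integral_cmult) measurable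
    finally show ?thesis using r by (simp add: power_add ennreal_mult mult.assoc)
  qed
  \<comment> \<open>The half-lines \<open>{..r}\<close> form an intersection-stable generator of the
    Borel sets, and by \<open>fin\<close> those that exhaust the line have finite mass.\<close>
  have "D p = D q"
  proof (rule measure_eqI_generator_eq[where E = "range atMost" and A = "\<lambda>n. {..real n}"])
    show "Int_stable (range (atMost :: real \<Rightarrow> _))" by (auto intro!: Int_stableI)
    show "sets (D p) = sigma_sets UNIV (range atMost)" "sets (D q) = sigma_sets UNIV (range atMost)"
      by (simp_all add: D_def borel_eq_atMost)
    show "emeasure (D p) X = emeasure (D q) X" if range: "X \<in> range atMost" for X
    proof -
      obtain r where X: "X = {..r}" using range by auto
      show ?thesis
        by (cases "r > 0") (simp_all add: X em[OF _ _ hp] em[OF _ _ hq] em0 eq)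
    qed
    show "(\<Union>n. {..real n}) = UNIV" using real_arch_simple by auto
    show "emeasure (D p) {..real n} \<noteq> \<infinity>" for n
      using fin by (cases "n > 0") (auto simp: em[OF _ _ hp] em0 ennreal_mult_eq_top_iff)
  qed auto
  moreover have "(\<integral>\<^sup>+x. g (body_norm K x) * p x \<partial>lborel) = (\<integral>\<^sup>+x. g x \<partial>D p)"
    if [measurable]: "p \<in> borel_measurable borel" for p
    unfolding D_def by (subst nn_integral_distr, simp, simp, subst nn_integral_density)
      (simp_all add: mult.commute)
  ultimately show ?thesis by simp
qed

section \<open>Moments of a body in a direction\<close>

definition moment :: "'a::euclidean_space set \<Rightarrow> 'a \<Rightarrow> nat \<Rightarrow> real" where
  "moment K \<xi> m = (\<integral>x. indicat_real K x * (x \<bullet> \<xi>) ^ m \<partial>lborel)"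

lemma moment_integrable:
  assumes "compact K"
  shows "integrable lborel (\<lambda>x. indicat_real K x * (x \<bullet> \<xi>) ^ m)"
  using borel_integrable_compact[OF assms, of "\<lambda>x. (x \<bullet> \<xi>) ^ m"]
  by (simp add: continuous_intros)

lemma nn_integral_moment:
  assumes "compact K" "even m"
  shows "(\<integral>\<^sup>+x. indicator K x * ennreal ((x \<bullet> \<xi>) ^ m) \<partial>lborel) = ennreal (moment K \<xi> m)"
proof -
  have "(\<integral>\<^sup>+x. indicator K x * ennreal ((x \<bullet> \<xi>) ^ m) \<partial>lborel)
      = (\<integral>\<^sup>+x. ennreal (indicat_real K x * (x \<bullet> \<xi>) ^ m) \<partial>lborel)"
    by (intro nn_integral_cong) (auto simp: indicator_def)
  also have "\<dots> = ennreal (moment K \<xi> m)"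
    unfolding moment_def using assms
    by (intro nn_integral_eq_integral moment_integrable) (auto simp: zero_le_even_power)
  finally show ?thesis .
qed

lemma moment_scaleR: "moment K (c *\<^sub>R \<xi>) m = c ^ m * moment K \<xi> m"
  unfolding moment_def by (simp add: power_mult_distrib mult.left_commute flip: integral_mult_right_zero)

text \<open>Reflection in the origin preserves \<open>K\<close> and Lebesgue measure but changes the
  sign of the integrand.\<close>

lemma moment_odd:
  assumes K: "symmetric_body K" and "odd m"
  shows "moment K \<xi> m = 0"
proof -
  note [measurable] = symmetric_bodyD(3)[OF K]
  have "moment K \<xi> m = (\<integral>x. indicat_real K x * (x \<bullet> \<xi>) ^ m \<partial>distr lborel borel uminus)"
    using lborel_affine[of "-1" "0::'a"] by (simp add: moment_def density_1)
  also have "\<dots> = (\<integral>x. indicat_real K (- x) * ((- x) \<bullet> \<xi>) ^ m \<partial>lborel)"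
    by (rule integral_distr) auto
  also have "\<dots> = (\<integral>x. - (indicat_real K x * (x \<bullet> \<xi>) ^ m) \<partial>lborel)"
    using symmetric_bodyD(4)[OF K] \<open>odd m\<close> by (intro Bochner_Integration.integral_cong) (auto simp: indicator_def)
  finally show ?thesis by (simp add: moment_def)
qed

section \<open>The overlap volume as a convolution\<close>

text \<open>By symmetry of \<open>K\<close>, y lies in x + \<tau>K exactly when (x - y)/\<tau> lies
  in \<open>K\<close>, which is the form a convolution needs.\<close>

lemma overlap_volume_nn_integral:
  fixes K :: "'a::euclidean_space set"
  assumes K: "symmetric_body K" and \<tau>: "\<tau> > 0"
  shows "ennreal (overlap_volume K \<tau> x)
    = (\<integral>\<^sup>+y. indicator K y * indicator K ((x - y) /\<^sub>R \<tau>) \<partial>lborel)"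
proof -
  have "(\<lambda>y. x + \<tau> *\<^sub>R y) ` K = {y. (y - x) /\<^sub>R \<tau> \<in> K}"
    using \<tau> by (force simp: image_iff)
  moreover have "(y - x) /\<^sub>R \<tau> = - ((x - y) /\<^sub>R \<tau>)" for y by (simp add: algebra_simps)
  ultimately have *: "y \<in> (\<lambda>y. x + \<tau> *\<^sub>R y) ` K \<longleftrightarrow> (x - y) /\<^sub>R \<tau> \<in> K" for y
    using symmetric_bodyD(4)[OF K] by (metis (no_types, lifting) mem_Collect_eq)
  let ?A = "K \<inter> (\<lambda>y. x + \<tau> *\<^sub>R y) ` K"
  have c: "compact ?A" using symmetric_bodyD(1)[OF K]
    by (intro compact_Int compact_continuous_image continuous_intros) auto
  then have b: "?A \<in> sets borel" by (intro borel_closed compact_imp_closed)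
  have "ennreal (overlap_volume K \<tau> x) = emeasure lborel ?A"
    using b emeasure_compact_finite[OF c]
    by (simp add: overlap_volume_def emeasure_eq_ennreal_measure measure_completion)
  also have "\<dots> = (\<integral>\<^sup>+y. indicator ?A y \<partial>lborel)" using b by simp
  also have "\<dots> = (\<integral>\<^sup>+y. indicator K y * indicator K ((x - y) /\<^sub>R \<tau>) \<partial>lborel)"
    using * by (intro nn_integral_cong) (auto simp: indicator_def)
  finally show ?thesis .
qed

lemma overlap_volume_nonneg [simp]: "overlap_volume K \<tau> x \<ge> 0"
  by (simp add: overlap_volume_def)

lemma borel_measurable_overlap_volume:
  fixes K :: "'a::euclidean_space set"
  assumes K: "symmetric_body K" and \<tau>: "\<tau> > 0"
  shows "overlap_volume K \<tau> \<in> borel_measurable borel"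
proof -
  note [measurable] = symmetric_bodyD(3)[OF K]
  have "(\<lambda>x. ennreal (overlap_volume K \<tau> x)) \<in> borel_measurable borel"
    unfolding overlap_volume_nn_integral[OF assms] by measurable
  then have "(\<lambda>x. enn2real (ennreal (overlap_volume K \<tau> x))) \<in> borel_measurable borel"
    by measurable
  then show ?thesis by simp
qed

text \<open>Tonelli's theorem, then the substitution x = y + \<tau>z for fixed y, whose Jacobian is
  the power of \<tau> in front.\<close>

lemma nn_integral_overlap_volume:
  fixes K :: "'a::euclidean_space set"
  assumes K: "symmetric_body K" and \<tau>: "\<tau> > 0" and [measurable]: "p \<in> borel_measurable borel"
  shows "(\<integral>\<^sup>+x. ennreal (overlap_volume K \<tau> x) * p x \<partial>lborel)
    = ennreal (\<tau> ^ DIM('a)) *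
      (\<integral>\<^sup>+y. indicator K y * (\<integral>\<^sup>+z. indicator K z * p (y + \<tau> *\<^sub>R z) \<partial>lborel) \<partial>lborel)"
proof -
  note [measurable] = symmetric_bodyD(3)[OF K]
  have "(\<integral>\<^sup>+x. ennreal (overlap_volume K \<tau> x) * p x \<partial>lborel)
      = (\<integral>\<^sup>+x. \<integral>\<^sup>+y. indicator K y * (indicator K ((x - y) /\<^sub>R \<tau>) * p x) \<partial>lborel \<partial>lborel)"
    unfolding overlap_volume_nn_integral[OF K \<tau>]
    by (subst nn_integral_multc[symmetric]) (simp_all add: mult.assoc)
  also have "\<dots> = (\<integral>\<^sup>+y. \<integral>\<^sup>+x. indicator K y * (indicator K ((x - y) /\<^sub>R \<tau>) * p x) \<partial>lborel \<partial>lborel)"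
    by (rule lborel_pair.Fubini'[symmetric]) measurable
  also have "\<dots> = (\<integral>\<^sup>+y. indicator K y * (\<integral>\<^sup>+x. indicator K ((x - y) /\<^sub>R \<tau>) * p x \<partial>lborel) \<partial>lborel)"
    by (intro nn_integral_cong nn_integral_cmult) measurable
  also have "\<dots> = (\<integral>\<^sup>+y. ennreal (\<tau> ^ DIM('a)) *
      (indicator K y * (\<integral>\<^sup>+z. indicator K z * p (y + \<tau> *\<^sub>R z) \<partial>lborel)) \<partial>lborel)"
  proof (intro nn_integral_cong)
    fix y :: 'a
    have "(\<integral>\<^sup>+x. indicator K ((x - y) /\<^sub>R \<tau>) * p x \<partial>lborel)
        = ennreal (\<bar>\<tau>\<bar> ^ DIM('a)) *
          (\<integral>\<^sup>+z. indicator K (((y + \<tau> *\<^sub>R z) - y) /\<^sub>R \<tau>) * p (y + \<tau> *\<^sub>R z) \<partial>lborel)"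
      using \<tau> by (intro nn_integral_lborel_affine) auto
    also have "\<dots> = ennreal (\<tau> ^ DIM('a)) * (\<integral>\<^sup>+z. indicator K z * p (y + \<tau> *\<^sub>R z) \<partial>lborel)"
      using \<tau> by simp
    finally show "indicator K y * (\<integral>\<^sup>+x. indicator K ((x - y) /\<^sub>R \<tau>) * p x \<partial>lborel)
        = ennreal (\<tau> ^ DIM('a)) * (indicator K y * (\<integral>\<^sup>+z. indicator K z * p (y + \<tau> *\<^sub>R z) \<partial>lborel))"
      by (simp add: mult_ac)
  qed
  also have "\<dots> = ennreal (\<tau> ^ DIM('a)) *
      (\<integral>\<^sup>+y. indicator K y * (\<integral>\<^sup>+z. indicator K z * p (y + \<tau> *\<^sub>R z) \<partial>lborel) \<partial>lborel)"
    by (rule nn_integral_cmult) measurable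
  finally show ?thesis .
qed

text \<open>The binomial expansion of the m-th power of (y + \<tau>z) \<bullet> \<xi> separates y
  from z, so each term integrates to a product of two moments.\<close>

lemma nn_integral_overlap_volume_power:
  fixes K :: "'a::euclidean_space set"
  assumes K: "symmetric_body K" and \<tau>: "\<tau> > 0" and m: "even m"
  shows "(\<integral>\<^sup>+x. ennreal (overlap_volume K \<tau> x) * ennreal ((x \<bullet> \<xi>) ^ m) \<partial>lborel)
    = ennreal (\<tau> ^ DIM('a) *
      (\<Sum>k\<le>m. real (m choose k) * \<tau> ^ (m - k) * moment K \<xi> k * moment K \<xi> (m - k)))"
proof -
  note int = moment_integrable[OF symmetric_bodyD(1)[OF K]]
  \<comment> \<open>\<open>S t\<close> is the inner integral over z when y \<bullet> \<xi> = t. It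
    is a polynomial in t, so integrating it over y yields moments again.\<close>
  define S where "S t = (\<Sum>k\<le>m. real (m choose k) * \<tau> ^ (m - k) * moment K \<xi> (m - k) * t ^ k)" for t :: real
  have S: "has_bochner_integral lborel (\<lambda>z. indicat_real K z * ((y + \<tau> *\<^sub>R z) \<bullet> \<xi>) ^ m) (S (y \<bullet> \<xi>))" for y
  proof -
    have "has_bochner_integral lborel
       (\<lambda>z. \<Sum>k\<le>m. (real (m choose k) * \<tau> ^ (m - k) * (y \<bullet> \<xi>) ^ k) * (indicat_real K z * (z \<bullet> \<xi>) ^ (m - k)))
       (\<Sum>k\<le>m. (real (m choose k) * \<tau> ^ (m - k) * (y \<bullet> \<xi>) ^ k) * moment K \<xi> (m - k))"
      unfolding moment_def using int
      by (intro has_bochner_integral_sum has_bochner_integral_mult_right has_bochner_integral_integrable)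
    moreover have "(\<Sum>k\<le>m. (real (m choose k) * \<tau> ^ (m - k) * (y \<bullet> \<xi>) ^ k) * moment K \<xi> (m - k)) = S (y \<bullet> \<xi>)"
      by (simp add: S_def mult_ac)
    moreover have "(\<lambda>z. \<Sum>k\<le>m. (real (m choose k) * \<tau> ^ (m - k) * (y \<bullet> \<xi>) ^ k) * (indicat_real K z * (z \<bullet> \<xi>) ^ (m - k)))
      = (\<lambda>z. indicat_real K z * ((y + \<tau> *\<^sub>R z) \<bullet> \<xi>) ^ m)"
      by (intro ext) (simp add: inner_add_left binomial_ring sum_distrib_left power_mult_distrib mult_ac)
    ultimately show ?thesis by simp
  qed
  \<comment> \<open>Nonnegativity is inherited from the even power under the integral; it permits
    the change from Bochner to nonnegative integrals in the outer variable.\<close>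
  have S0: "S (y \<bullet> \<xi>) \<ge> 0" for y
    using S[of y] m
    by (auto simp: has_bochner_integral_iff zero_le_even_power intro!: integral_nonneg_AE simp flip: has_bochner_integral_integral_eq[OF S])
  have inner: "(\<integral>\<^sup>+z. indicator K z * ennreal (((y + \<tau> *\<^sub>R z) \<bullet> \<xi>) ^ m) \<partial>lborel) = ennreal (S (y \<bullet> \<xi>))" for y
  proof -
    have "(\<integral>\<^sup>+z. indicator K z * ennreal (((y + \<tau> *\<^sub>R z) \<bullet> \<xi>) ^ m) \<partial>lborel)
        = (\<integral>\<^sup>+z. ennreal (indicat_real K z * ((y + \<tau> *\<^sub>R z) \<bullet> \<xi>) ^ m) \<partial>lborel)"
      by (intro nn_integral_cong) (auto simp: indicator_def)
    also have "\<dots> = ennreal (S (y \<bullet> \<xi>))" using S[of y] m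
      by (subst nn_integral_eq_integral) (auto simp: has_bochner_integral_iff zero_le_even_power)
    finally show ?thesis .
  qed
  have out: "has_bochner_integral lborel (\<lambda>y. indicat_real K y * S (y \<bullet> \<xi>))
      (\<Sum>k\<le>m. real (m choose k) * \<tau> ^ (m - k) * moment K \<xi> k * moment K \<xi> (m - k))"
  proof -
    have "has_bochner_integral lborel
       (\<lambda>y. \<Sum>k\<le>m. (real (m choose k) * \<tau> ^ (m - k) * moment K \<xi> (m - k)) * (indicat_real K y * (y \<bullet> \<xi>) ^ k))
       (\<Sum>k\<le>m. (real (m choose k) * \<tau> ^ (m - k) * moment K \<xi> (m - k)) * moment K \<xi> k)"
      unfolding moment_def[of K \<xi> k for k] using int
      by (intro has_bochner_integral_sum has_bochner_integral_mult_right has_bochner_integral_integrable)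
    then show ?thesis by (simp add: S_def sum_distrib_left mult_ac)
  qed
  have "(\<integral>\<^sup>+y. indicator K y * ennreal (S (y \<bullet> \<xi>)) \<partial>lborel)
      = (\<integral>\<^sup>+y. ennreal (indicat_real K y * S (y \<bullet> \<xi>)) \<partial>lborel)"
    by (intro nn_integral_cong) (auto simp: indicator_def)
  also have "\<dots> = ennreal (\<Sum>k\<le>m. real (m choose k) * \<tau> ^ (m - k) * moment K \<xi> k * moment K \<xi> (m - k))"
    using out S0 by (subst nn_integral_eq_integral) (auto simp: has_bochner_integral_iff)
  finally show ?thesis
    using \<tau> by (subst nn_integral_overlap_volume[OF K \<tau>]) (simp_all add: inner ennreal_mult')
qed

section \<open>Support functions and linear images of the ball\<close>

text \<open>Cauchy-Schwarz after moving \<open>f\<close> to the other side. With the attainment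
  lemma below, this identifies the support function of the image of the ball.\<close>

lemma linear_image_cball_support_le:
  fixes f :: "'a::euclidean_space \<Rightarrow> 'a"
  assumes "linear f" "y \<in> f ` cball 0 1"
  shows "y \<bullet> \<xi> \<le> norm (adjoint f \<xi>)"
proof -
  obtain u where u: "y = f u" "norm u \<le> 1" using assms by auto
  have "y \<bullet> \<xi> = u \<bullet> adjoint f \<xi>" using adjoint_works[OF assms(1)] u by (simp add: inner_commute)
  also have "\<dots> \<le> norm u * norm (adjoint f \<xi>)" by (rule norm_cauchy_schwarz)
  also have "\<dots> \<le> norm (adjoint f \<xi>)" using u by (simp add: mult_left_le_one_le)
  finally show ?thesis .
qed

lemma linear_image_cball_support_attained:
  fixes f :: "'a::euclidean_space \<Rightarrow> 'a"
  assumes "linear f"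
  obtains y where "y \<in> f ` cball 0 1" "y \<bullet> \<xi> = norm (adjoint f \<xi>)"
proof
  \<comment> \<open>The equality case of Cauchy-Schwarz; \<open>sgn 0 = 0\<close> keeps
    \<open>?u\<close> in the ball when the adjoint vanishes at \<xi>.\<close>
  let ?u = "sgn (adjoint f \<xi>)"
  show "f ?u \<in> f ` cball 0 1" by (auto simp: norm_sgn)
  have "f ?u \<bullet> \<xi> = ?u \<bullet> adjoint f \<xi>" using adjoint_works[OF assms] by simp
  then show "f ?u \<bullet> \<xi> = norm (adjoint f \<xi>)"
    by (cases "adjoint f \<xi> = 0") (simp_all add: sgn_div_norm dot_square_norm power2_eq_square)
qed

text \<open>A point outside a closed convex set is strictly separated from it by a hyperplane, whose
  normal would violate the comparison of support functions.\<close>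

lemma subset_if_support_le:
  fixes A B :: "'a::euclidean_space set"
  assumes "convex B" "closed B"
    and le: "\<And>\<xi> x. x \<in> A \<Longrightarrow> \<exists>y\<in>B. x \<bullet> \<xi> \<le> y \<bullet> \<xi>"
  shows "A \<subseteq> B"
proof
  fix x assume "x \<in> A"
  show "x \<in> B"
  proof (rule ccontr)
    assume "x \<notin> B"
    then obtain a b where ab: "a \<bullet> x < b" "\<forall>y\<in>B. a \<bullet> y > b"
      using separating_hyperplane_closed_point[OF assms(1,2)] by metis
    \<comment> \<open>The separation puts \<open>x\<close> on the lower side of \<open>a\<close>,
      hence the direction \<open>- a\<close>.\<close>
    obtain y where "y \<in> B" "x \<bullet> (- a) \<le> y \<bullet> (- a)" using le \<open>x \<in> A\<close> by blast
    with ab show False by (auto simp: inner_commute dest: bspec)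
  qed
qed

text \<open>The image of the unit ball under \<open>adjoint L\<close> has support function
  \<open>norm (L \<xi>)\<close>, and compact convex sets with equal support functions
  coincide.\<close>

lemma ellipsoid_if_support:
  fixes K :: "'a::euclidean_space set"
  assumes K: "compact K" "convex K" and L: "linear (L :: 'a \<Rightarrow> 'a)" "inj L"
    and le: "\<And>x \<xi>. x \<in> K \<Longrightarrow> x \<bullet> \<xi> \<le> norm (L \<xi>)"
    and attained: "\<And>\<xi>. \<exists>x\<in>K. x \<bullet> \<xi> = norm (L \<xi>)"
  shows "ellipsoid K"
proof -
  define f where "f = adjoint L"
  have f: "linear f" unfolding f_def by (rule adjoint_linear[OF L(1)])
  have aL: "adjoint f = L" unfolding f_def by (rule adjoint_adjoint[OF L(1)])
  have "surj L" using linear_injective_imp_surjective L by blast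
  have "inj f"
  proof (subst linear_injective_0[OF f], intro allI impI)
    fix x assume "f x = 0"
    obtain y where "x = L y" using \<open>surj L\<close> by (metis surjD)
    then have "x \<bullet> x = y \<bullet> f x" unfolding f_def using adjoint_works[OF L(1)] by (simp add: inner_commute)
    with \<open>f x = 0\<close> show "x = 0" by simp
  qed
  then have "bij f" using linear_injective_imp_surjective f by (auto simp: bij_def)
  have "compact (f ` cball 0 1)" "convex (f ` cball 0 1)"
    using f by (auto intro!: compact_continuous_image linear_continuous_on convex_linear_image
      simp: linear_conv_bounded_linear)
  note E = this
  have "K \<subseteq> f ` cball 0 1"
  proof (rule subset_if_support_le[OF E(2) compact_imp_closed[OF E(1)]])
    fix \<xi> x assume "x \<in> K"
    then show "\<exists>y\<in>f ` cball 0 1. x \<bullet> \<xi> \<le> y \<bullet> \<xi>"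
      using linear_image_cball_support_attained[OF f, of \<xi>] le[of x \<xi>] aL by metis
  qed
  moreover have "f ` cball 0 1 \<subseteq> K"
  proof (rule subset_if_support_le[OF K(2) compact_imp_closed[OF K(1)]])
    fix \<xi> x assume "x \<in> f ` cball 0 1"
    then show "\<exists>y\<in>K. x \<bullet> \<xi> \<le> y \<bullet> \<xi>"
      using linear_image_cball_support_le[OF f, of x \<xi>] attained[of \<xi>] aL by metis
  qed
  ultimately show ?thesis unfolding ellipsoid_def using f \<open>bij f\<close> by blast
qed

section \<open>Positive definite forms as squared norms\<close>

text \<open>Gram--Schmidt for an arbitrary positive definite form.\<close>

lemma bilinear_form_norm_representation:
  fixes B :: "'a::euclidean_space \<Rightarrow> 'a \<Rightarrow> real"
  assumes B: "bilinear B" and sym: "\<And>x y. B x y = B y x" and pos: "\<And>x. x \<noteq> 0 \<Longrightarrow> B x x > 0"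
  obtains L :: "'a \<Rightarrow> 'a" where "linear L" "inj L" "\<And>x. (norm (L x))\<^sup>2 = B x x"
proof -
  note lin = bilinear_ladd[OF B] bilinear_radd[OF B] bilinear_lmul[OF B] bilinear_rmul[OF B]
    bilinear_lsub[OF B] bilinear_rsub[OF B] bilinear_lzero[OF B] bilinear_rzero[OF B]
  have linB: "linear (\<lambda>y. B y x)" "linear (B x)" for x using B by (auto simp: bilinear_def)
  define orth where "orth S \<longleftrightarrow> finite S \<and> (\<forall>s\<in>S. \<forall>t\<in>S. B s t = (if s = t then 1 else 0))" for S
  have expand: "B (\<Sum>s\<in>S. c s *\<^sub>R s) t = c t" if "orth S" "t \<in> S" for S c t
  proof -
    have "B (\<Sum>s\<in>S. c s *\<^sub>R s) t = (\<Sum>s\<in>S. c s * B s t)"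
      using linB(1) by (simp add: linear_sum[OF linB(1)] lin)
    also have "\<dots> = (\<Sum>s\<in>S. if s = t then c s else 0)"
      using that by (intro sum.cong) (auto simp: orth_def)
    finally show ?thesis using that by (simp add: orth_def)
  qed
  have indep: "independent S" if "orth S" for S
  proof (rule independent_if_scalars_zero)
    show "finite S" using that by (simp add: orth_def)
    fix c t assume "(\<Sum>s\<in>S. c s *\<^sub>R s) = 0" "t \<in> S"
    then show "c t = 0" using expand[OF that, of t c] lin by simp
  qed
  \<comment> \<open>A \<open>B\<close>-orthonormal set is independent, so its cardinality is at most
    the dimension and a largest one exists; the rule wants a strict bound, hence
    \<open>Suc\<close>.\<close>
  have "\<exists>S. orth S \<and> (\<forall>T. orth T \<longrightarrow> card T \<le> card S)"
  proof (rule ex_has_greatest_nat[where b = "Suc DIM('a)"])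
    show "orth {}" by (simp add: orth_def)
    show "\<forall>T. orth T \<longrightarrow> card T < Suc DIM('a)"
    proof (intro allI impI)
      fix T assume "orth T"
      then show "card T < Suc DIM('a)" using independent_bound[OF indep[of T]] by linarith
    qed
  qed
  then obtain S where S: "orth S" and max: "\<And>T. orth T \<Longrightarrow> card T \<le> card S" by blast
  \<comment> \<open>Otherwise the residual of the expansion, which is \<open>B\<close>-orthogonal to
    \<open>S\<close>, could be normalised and added to \<open>S\<close>, against maximality.\<close>
  have span: "(\<Sum>s\<in>S. B x s *\<^sub>R s) = x" for x
  proof (rule ccontr)
    assume "(\<Sum>s\<in>S. B x s *\<^sub>R s) \<noteq> x"
    define v where "v = x - (\<Sum>s\<in>S. B x s *\<^sub>R s)"
    have "v \<noteq> 0" using \<open>_ \<noteq> x\<close> by (auto simp: v_def)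
    then have p: "B v v > 0" by (rule pos)
    have z: "B v s = 0" "B s v = 0" if "s \<in> S" for s
      using expand[OF S that, of "B x"] sym[of s v] by (simp_all add: v_def lin)
    define w where "w = v /\<^sub>R sqrt (B v v)"
    have "B w w = inverse (sqrt (B v v)) * (inverse (sqrt (B v v)) * B v v)"
      unfolding w_def bilinear_lmul[OF B] bilinear_rmul[OF B] by simp
    also have "\<dots> = B v v / (sqrt (B v v))\<^sup>2"
      by (simp only: power2_eq_square divide_inverse inverse_mult_distrib mult_ac)
    also have "\<dots> = 1" using p by simp
    finally have ww: "B w w = 1" .
    have wz: "B w s = 0" "B s w = 0" if "s \<in> S" for s
      unfolding w_def bilinear_lmul[OF B] bilinear_rmul[OF B] by (simp_all add: z[OF that])
    have "w \<notin> S" using ww wz(1)[of w] by auto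
    moreover have "orth (insert w S)" using S ww wz \<open>w \<notin> S\<close> by (auto simp: orth_def)
    ultimately show False using max[of "insert w S"] S by (simp add: orth_def)
  qed
  have "card S = DIM('a)"
  proof -
    have "x \<in> span S" for x
      by (subst span[of x, symmetric]) (intro span_sum span_scale span_base)
    then have "span S = UNIV" by blast
    then have "dim S = DIM('a)" using dim_span[of S] by simp
    then show ?thesis using dim_eq_card_independent[OF indep[OF S]] by simp
  qed
  \<comment> \<open>Matching \<open>S\<close> with the standard basis gives a map \<open>L\<close>
    that sends each \<open>s\<close> to \<open>e s\<close> and so carries \<open>B\<close> to the
    inner product.\<close>
  then obtain e where e: "bij_betw e S (Basis :: 'a set)"
    using finite_same_card_bij[of S "Basis :: 'a set"] S by (auto simp: orth_def)
  define L where "L x = (\<Sum>s\<in>S. B x s *\<^sub>R e s)" for x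
  have L: "linear L"
  proof (rule linearI)
    show "L (x + y) = L x + L y" for x y
      unfolding L_def bilinear_ladd[OF B] scaleR_add_left sum.distrib ..
    show "L (c *\<^sub>R x) = c *\<^sub>R L x" for c x
      unfolding L_def bilinear_lmul[OF B] scaleR_sum_right by simp
  qed
  have norm: "(norm (L x))\<^sup>2 = B x x" for x
  proof -
    have ee: "e s \<bullet> e t = (if s = t then 1 else 0)" if "s \<in> S" "t \<in> S" for s t
    proof -
      have "e s \<in> Basis" "e t \<in> Basis" using that e by (auto simp: bij_betw_def)
      moreover have "e s = e t \<longleftrightarrow> s = t" using that e by (auto simp: bij_betw_def inj_on_eq_iff)
      ultimately show ?thesis by (simp add: inner_Basis)
    qed
    have "(norm (L x))\<^sup>2 = (\<Sum>s\<in>S. \<Sum>t\<in>S. B x s * (B x t * (e s \<bullet> e t)))"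
      unfolding power2_norm_eq_inner L_def
      by (simp add: inner_sum_left inner_sum_right sum_distrib_left inner_commute mult_ac)
    also have "\<dots> = (\<Sum>s\<in>S. \<Sum>t\<in>S. if s = t then B x s * B x t else 0)"
      using ee by (intro sum.cong) auto
    also have "\<dots> = (\<Sum>s\<in>S. B x s * B x s)" using S by (simp add: orth_def)
    also have "\<dots> = B x (\<Sum>s\<in>S. B x s *\<^sub>R s)"
      by (simp add: linear_sum[OF linB(2)] bilinear_rmul[OF B])
    also have "\<dots> = B x x" by (simp only: span)
    finally show ?thesis .
  qed
  moreover have "inj L"
    unfolding linear_injective_0[OF L] using norm pos by (metis norm_zero zero_power2 less_irrefl)
  ultimately show thesis using L that by blast
qed

section \<open>Linear maps and volume; the overlap property of ellipsoids\<close>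

text \<open>The two sides are the two orders of integration of the convolution of the indicators
  of \<open>A\<close> and \<open>B\<close>, as in the uniqueness proof for Haar measure; no determinant is involved.\<close>

lemma emeasure_linear_vimage_cross:
  fixes h :: "'a::euclidean_space \<Rightarrow> 'a"
  assumes h: "linear h" "surj h" and [measurable]: "A \<in> sets borel" "B \<in> sets borel"
  shows "emeasure lborel B * emeasure lborel (h -` A) = emeasure lborel (h -` B) * emeasure lborel A"
proof -
  have [measurable]: "h \<in> borel_measurable borel"
    using h(1) by (intro borel_measurable_continuous_onI linear_continuous_on) (simp add: linear_conv_bounded_linear)
  have vimage: "h -` C \<in> sets borel" if "C \<in> sets borel" for C
    using measurable_sets[of h borel borel C] that by simp
  have transl: "(\<integral>\<^sup>+y. indicator C (y - a) \<partial>lborel) = emeasure lborel C" if [measurable]: "C \<in> sets borel" for C and a :: 'a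
  proof -
    have "(\<integral>\<^sup>+y. indicator C (y - a) \<partial>lborel) = (\<integral>\<^sup>+y. indicator C y \<partial>lborel)"
      using nn_integral_lborel_affine[of 1 "\<lambda>y. indicator C (y - a)" a] by simp
    then show ?thesis by simp
  qed
  have vol: "(\<integral>\<^sup>+x. indicator C (h x) \<partial>lborel) = emeasure lborel (h -` C)" if "C \<in> sets borel" for C
    using vimage[OF that] by (simp flip: indicator_vimage)
  have "emeasure lborel B * emeasure lborel (h -` A)
      = (\<integral>\<^sup>+x. indicator A (h x) * emeasure lborel B \<partial>lborel)"
    by (simp add: nn_integral_multc vol) (simp add: mult.commute)
  also have "\<dots> = (\<integral>\<^sup>+x. \<integral>\<^sup>+y. indicator A (h x) * indicator B (y - h x) \<partial>lborel \<partial>lborel)"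
    by (simp add: nn_integral_cmult transl)
  also have "\<dots> = (\<integral>\<^sup>+y. \<integral>\<^sup>+x. indicator A (h x) * indicator B (y - h x) \<partial>lborel \<partial>lborel)"
    by (rule lborel_pair.Fubini'[symmetric]) measurable
  \<comment> \<open>With \<open>y = h t\<close> by surjectivity, the measure-preserving map sending
    x to t - x interchanges \<open>h x\<close> and \<open>y - h x\<close>.\<close>
  also have "\<dots> = (\<integral>\<^sup>+y. \<integral>\<^sup>+x. indicator A (y - h x) * indicator B (h x) \<partial>lborel \<partial>lborel)"
  proof (rule nn_integral_cong)
    fix y :: 'a
    obtain t where t: "y = h t" using h(2) by (metis surjD)
    have "h (t + (-1) *\<^sub>R x) = y - h x" for x using h(1) t by (simp add: linear_diff)
    then show "(\<integral>\<^sup>+x. indicator A (h x) * indicator B (y - h x) \<partial>lborel)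
        = (\<integral>\<^sup>+x. indicator A (y - h x) * indicator B (h x) \<partial>lborel)"
      by (subst nn_integral_lborel_affine[of "-1" _ t]) simp_all
  qed
  also have "\<dots> = (\<integral>\<^sup>+x. \<integral>\<^sup>+y. indicator A (y - h x) * indicator B (h x) \<partial>lborel \<partial>lborel)"
    by (rule lborel_pair.Fubini') measurable
  also have "\<dots> = (\<integral>\<^sup>+x. emeasure lborel A * indicator B (h x) \<partial>lborel)"
    by (simp add: nn_integral_multc transl)
  also have "\<dots> = emeasure lborel (h -` B) * emeasure lborel A"
    by (simp add: nn_integral_cmult vol mult.commute)
  finally show ?thesis .
qed

lemma symmetric_body_emeasure_pos:
  assumes K: "symmetric_body K"
  shows "emeasure lborel K > 0"
proof -
  obtain e where e: "e > 0" "cball 0 e \<subseteq> K" using symmetric_body_contains_ball[OF K] .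
  have "0 < emeasure lborel (cball (0 :: 'a) e)" using e by (simp add: emeasure_cball ennreal_zero_less_mult_iff unit_ball_vol_pos)
  also have "\<dots> \<le> emeasure lborel K" using e symmetric_bodyD(3)[OF K] by (intro emeasure_mono) auto
  finally show ?thesis .
qed

lemma body_norm_linear_image_cball:
  assumes f: "linear f" "bij f" and K: "symmetric_body K" "K = f ` cball 0 1"
  shows "body_norm K (f u) = norm u"
proof (rule body_norm_eqI[OF K(1)])
  fix r :: real assume "r > 0"
  have "f u /\<^sub>R r = f (u /\<^sub>R r)" using f(1) by (simp add: linear_scale)
  then have "f u /\<^sub>R r \<in> K \<longleftrightarrow> norm (u /\<^sub>R r) \<le> 1"
    using f(2) inj_image_mem_iff[of f] unfolding K(2) by (simp add: bij_def)
  then show "f u /\<^sub>R r \<in> K \<longleftrightarrow> norm u \<le> r"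
    using \<open>r > 0\<close> by (simp add: inverse_eq_divide)
qed simp

text \<open>The scale \<tau> = 1 serves as witness. A linear symmetry of \<open>K\<close> taking
  \<open>x\<close> to \<open>y\<close> carries one intersection onto the other.\<close>

lemma ellipsoid_imp_overlap_volume:
  fixes K :: "(real ^ 'n) set"
  assumes K: "symmetric_body K" and "ellipsoid K" "body_norm K x = body_norm K y"
  shows "overlap_volume K 1 x = overlap_volume K 1 y"
proof -
  obtain f :: "real ^ 'n \<Rightarrow> real ^ 'n" where f: "linear f" "bij f" "K = f ` cball 0 1"
    using assms by (auto simp: ellipsoid_def)
  obtain u v where uv: "x = f u" "y = f v" using f(2) by (metis bij_pointE)
  then have "norm u = norm v" using assms(3) body_norm_linear_image_cball[OF f(1,2) K f(3)] by simp
  then obtain g where g: "orthogonal_transformation g" "g u = v"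
    by (rule orthogonal_transformation_exists)
  \<comment> \<open>\<open>g\<close> is an orthogonal map taking \<open>u\<close> to
    \<open>v\<close>; conjugation by \<open>f\<close> transports it from the ball to
    \<open>K\<close>.\<close>
  define h where "h = f \<circ> g \<circ> inv f"
  have hf: "h (f z) = f (g z)" for z using f(2) by (simp add: h_def bij_is_inj)
  have inv: "linear (inv f)" using f by (intro inj_linear_imp_inv_linear) (auto simp: bij_def)
  have h: "linear h"
    unfolding h_def by (intro linear_compose inv f(1) orthogonal_transformation_linear[OF g(1)])
  have "bij h"
    unfolding h_def by (intro bij_comp bij_imp_bij_inv f(2) orthogonal_transformation_bij[OF g(1)])
  have KK: "h z \<in> K \<longleftrightarrow> z \<in> K" for z
  proof -
    obtain w where w: "z = f w" using f(2) by (metis bij_pointE)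
    have "norm (g w) = norm w" using g(1) by (simp add: orthogonal_transformation)
    then show ?thesis
      using f(2) inj_image_mem_iff[of f] unfolding w hf f(3) by (simp add: bij_def)
  qed
  have hx: "h x = y" by (simp add: uv hf g(2))
  define A where "A z = K \<inter> (\<lambda>w. z + 1 *\<^sub>R w) ` K" for z
  have mem: "w \<in> A z \<longleftrightarrow> w \<in> K \<and> w - z \<in> K" for w z
  proof -
    have "w \<in> (\<lambda>w. z + 1 *\<^sub>R w) ` K \<longleftrightarrow> w - z \<in> K"
      by (metis (no_types, lifting) add_diff_cancel_left' add_diff_cancel_right' add.commute diff_add_cancel image_iff scaleR_one)
    then show ?thesis by (simp add: A_def)
  qed
  have "compact (A z)" for z unfolding A_def using symmetric_bodyD(1)[OF K]
    by (intro compact_Int compact_continuous_image continuous_intros) auto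
  then have meas: "A z \<in> sets borel" for z by (intro borel_closed compact_imp_closed)
  \<comment> \<open>Taking \<open>K\<close> itself as the reference set shows that \<open>h\<close>
    preserves volume: \<open>K\<close> is its own preimage, and its measure is positive and finite,
    so it cancels.\<close>
  have "h -` K = K" using KK by auto
  moreover have "h w - y = h (w - x)" for w using h by (simp add: linear_diff hx)
  then have "h -` A y = A x" using KK by (auto simp: mem)
  ultimately have "emeasure lborel K * emeasure lborel (A x) = emeasure lborel K * emeasure lborel (A y)"
    using emeasure_linear_vimage_cross[OF h bij_is_surj[OF \<open>bij h\<close>] meas[of y] symmetric_bodyD(3)[OF K]] by simp
  moreover have "emeasure lborel K \<noteq> 0" "emeasure lborel K \<noteq> top"
    using symmetric_body_emeasure_pos[OF K] emeasure_compact_finite[OF symmetric_bodyD(1)[OF K]] by simp_all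
  ultimately have "emeasure lborel (A x) = emeasure lborel (A y)"
    unfolding ennreal_mult_cancel_left by blast
  then have "measure lborel (A x) = measure lborel (A y)" by (simp add: measure_def)
  then have "measure lebesgue (A x) = measure lebesgue (A y)" using meas by (simp add: measure_completion)
  then show ?thesis unfolding overlap_volume_def A_def .
qed

section \<open>Moment bounds and recovery of the support function\<close>

lemma symmetric_body_cap_fmeasurable:
  assumes K: "symmetric_body K"
  shows "K \<inter> {x. x \<bullet> \<xi> > s} \<in> fmeasurable lborel"
proof (rule fmeasurable_Int_fmeasurable)
  show "K \<in> fmeasurable lborel"
    using symmetric_bodyD(3)[OF K] emeasure_compact_finite[OF symmetric_bodyD(1)[OF K]]
    by (simp add: fmeasurable_def)
  have "open {x. x \<bullet> \<xi> > s}" by (intro open_Collect_less continuous_intros)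
  then show "{x. x \<bullet> \<xi> > s} \<in> sets lborel" by simp
qed

text \<open>A convex set with interior points lies in the closure of its interior, so the open
  half-space around \<open>x\<close> meets the interior and the cap contains a ball.\<close>

lemma symmetric_body_cap_measure_pos:
  assumes K: "symmetric_body K" and x: "x \<in> K" "x \<bullet> \<xi> > s"
  shows "measure lborel (K \<inter> {x. x \<bullet> \<xi> > s}) > 0"
proof -
  have op: "open {x. x \<bullet> \<xi> > s}" by (intro open_Collect_less continuous_intros)
  have "interior K \<noteq> {}" using K by (simp add: symmetric_body_def convex_body_def)
  then have "x \<in> closure (interior K)"
    using convex_closure_interior[OF symmetric_bodyD(2)[OF K]] x(1) closure_subset by blast
  then have "{x. x \<bullet> \<xi> > s} \<inter> interior K \<noteq> {}"
    using op x(2) by (simp add: closure_iff_nhds_not_empty open_Int_closure_eq_empty) blast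
  then obtain a where a: "a \<in> interior K \<inter> {x. x \<bullet> \<xi> > s}" by blast
  moreover have "open (interior K \<inter> {x. x \<bullet> \<xi> > s})" using op by (intro open_Int) auto
  ultimately obtain e where e: "e > 0" "cball a e \<subseteq> interior K \<inter> {x. x \<bullet> \<xi> > s}"
    using open_contains_cball by metis
  have meas: "K \<inter> {x. x \<bullet> \<xi> > s} \<in> sets borel"
    and fin: "emeasure lborel (K \<inter> {x. x \<bullet> \<xi> > s}) < \<infinity>"
    using symmetric_body_cap_fmeasurable[OF K, of s \<xi>] by (auto simp: fmeasurable_def)
  have "0 < emeasure lborel (cball a e)"
    using e by (simp add: emeasure_cball ennreal_zero_less_mult_iff unit_ball_vol_pos)
  also have "\<dots> \<le> emeasure lborel (K \<inter> {x. x \<bullet> \<xi> > s})"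
    using e meas interior_subset[of K] by (intro emeasure_mono) auto
  finally show ?thesis using fin by (simp add: measure_def enn2real_positive_iff)
qed

text \<open>Markov's inequality: the integrand is at least \<open>s ^ m\<close> on the cap and
  nonnegative elsewhere.\<close>

lemma moment_ge_cap:
  assumes K: "symmetric_body K" and s: "s \<ge> 0" and m: "even m"
  shows "s ^ m * measure lborel (K \<inter> {x. x \<bullet> \<xi> > s}) \<le> moment K \<xi> m"
proof -
  have meas: "K \<inter> {x. x \<bullet> \<xi> > s} \<in> sets borel"
    and fin: "emeasure lborel (K \<inter> {x. x \<bullet> \<xi> > s}) < \<infinity>"
    using symmetric_body_cap_fmeasurable[OF K, of s \<xi>] by (auto simp: fmeasurable_def)
  have "(\<integral>x. s ^ m * indicator (K \<inter> {x. x \<bullet> \<xi> > s}) x \<partial>lborel) \<le> moment K \<xi> m"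
    unfolding moment_def
  proof (rule integral_mono)
    show "integrable lborel (\<lambda>x. indicat_real K x * (x \<bullet> \<xi>) ^ m)"
      by (rule moment_integrable[OF symmetric_bodyD(1)[OF K]])
    show "integrable lborel (\<lambda>x. s ^ m * indicator (K \<inter> {x. x \<bullet> \<xi> > s}) x)"
      using meas fin by (intro integrable_mult_right integrable_real_indicator) auto
    show "s ^ m * indicator (K \<inter> {x. x \<bullet> \<xi> > s}) x \<le> indicat_real K x * (x \<bullet> \<xi>) ^ m" for x
      using s m by (auto simp: indicator_def zero_le_even_power intro: power_mono)
  qed
  then show ?thesis using meas by simp
qed

text \<open>Symmetry makes the one-sided bound \<open>b\<close> a bound on the absolute
  value.\<close>

lemma moment_le:
  assumes K: "symmetric_body K" and m: "even m" and b: "\<And>x. x \<in> K \<Longrightarrow> x \<bullet> \<xi> \<le> b"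
  shows "moment K \<xi> m \<le> b ^ m * measure lborel K"
proof -
  have abs: "\<bar>x \<bullet> \<xi>\<bar> \<le> b" if "x \<in> K" for x
    using b[OF that] b[of "- x"] symmetric_bodyD(4)[OF K] that by (auto simp: abs_le_iff)
  have "moment K \<xi> m \<le> (\<integral>x. b ^ m * indicator K x \<partial>lborel)"
    unfolding moment_def
  proof (rule integral_mono)
    show "integrable lborel (\<lambda>x. indicat_real K x * (x \<bullet> \<xi>) ^ m)"
      by (rule moment_integrable[OF symmetric_bodyD(1)[OF K]])
    show "integrable lborel (\<lambda>x. b ^ m * indicator K x)"
      using symmetric_bodyD(3)[OF K] emeasure_compact_finite[OF symmetric_bodyD(1)[OF K]]
      by (intro integrable_mult_right integrable_real_indicator) auto
    show "indicat_real K x * (x \<bullet> \<xi>) ^ m \<le> b ^ m * indicator K x" for x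
    proof (cases "x \<in> K")
      case True
      then have "\<bar>x \<bullet> \<xi>\<bar> ^ m \<le> b ^ m" using abs by (intro power_mono) auto
      then show ?thesis using True m by (simp add: power_even_abs)
    qed simp
  qed
  then show ?thesis using symmetric_bodyD(3)[OF K] by simp
qed

lemma moment_pos:
  assumes K: "symmetric_body K" and m: "even m" and "\<xi> \<noteq> 0"
  shows "moment K \<xi> m > 0"
proof -
  obtain e where e: "e > 0" "cball 0 e \<subseteq> K" using symmetric_body_contains_ball[OF K] .
  define x where "x = (e / norm \<xi>) *\<^sub>R \<xi>"
  have x: "x \<in> K" "x \<bullet> \<xi> > 0" using e \<open>\<xi> \<noteq> 0\<close> by (auto simp: x_def subset_iff)
  define s where "s = x \<bullet> \<xi> / 2"
  have s: "s > 0" "x \<bullet> \<xi> > s" using x by (auto simp: s_def)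
  have "0 < s ^ m * measure lborel (K \<inter> {x. x \<bullet> \<xi> > s})"
    using s x by (intro mult_pos_pos symmetric_body_cap_measure_pos[OF K x(1)]) auto
  also have "\<dots> \<le> moment K \<xi> m" using s m by (intro moment_ge_cap[OF K]) auto
  finally show ?thesis .
qed

text \<open>The even moments determine the support function, as a supremum norm is the limit of the \<open>L\<^sup>p\<close> norms.\<close>

lemma support_le_if_moments_eq:
  assumes K: "symmetric_body K" and eq: "\<And>k. moment K \<xi> (2 * k) = moment K \<eta> (2 * k)"
    and x: "x \<in> K" and y: "\<And>y. y \<in> K \<Longrightarrow> y \<bullet> \<eta> \<le> b"
  shows "x \<bullet> \<xi> \<le> b"
proof (rule ccontr)
  assume gt: "\<not> x \<bullet> \<xi> \<le> b"
  \<comment> \<open>A level strictly between \<open>b\<close> and x \<bullet> \<xi>: the cap above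
    it has positive measure, while \<open>b / s < 1\<close>.\<close>
  define s where "s = (b + x \<bullet> \<xi>) / 2"
  have b: "b \<ge> 0" using y[OF symmetric_body_zero_mem[OF K]] by simp
  have s: "s > b" "x \<bullet> \<xi> > s" using gt by (auto simp: s_def)
  define c where "c = measure lborel (K \<inter> {x. x \<bullet> \<xi> > s})"
  have c: "c > 0" unfolding c_def by (rule symmetric_body_cap_measure_pos[OF K x s(2)])
  \<comment> \<open>The cap bounds the moments of \<xi> from below and \<open>b\<close> bounds those
    of \<eta> from above; as the moments agree, the fixed c > 0 is at most a sequence tending to
    0.\<close>
  have le: "c \<le> ((b / s)\<^sup>2) ^ k * measure lborel K" for k
  proof -
    have "s ^ (2 * k) * c \<le> moment K \<xi> (2 * k)"
      unfolding c_def using s b by (intro moment_ge_cap[OF K]) auto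
    also have "\<dots> \<le> b ^ (2 * k) * measure lborel K"
      unfolding eq using y by (intro moment_le[OF K]) auto
    finally have "c \<le> b ^ (2 * k) * measure lborel K / s ^ (2 * k)"
      using s b by (simp add: pos_le_divide_eq mult.commute)
    then show ?thesis by (simp add: power_divide power_mult)
  qed
  have "(b / s)\<^sup>2 < 1" using s b by (simp add: abs_square_less_1)
  then have "(\<lambda>k. ((b / s)\<^sup>2) ^ k * measure lborel K) \<longlonglongrightarrow> 0 * measure lborel K"
    by (intro tendsto_mult tendsto_const LIMSEQ_realpow_zero) auto
  then have "c \<le> 0 * measure lborel K" using le by (intro LIMSEQ_le_const) auto
  with c show False by simp
qed

section \<open>Recursion for the moments\<close>

text \<open>The densities (x \<bullet> \<xi>)\<open>^m\<close> and (x \<bullet>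
  \<eta>)\<open>^m\<close>, scaled to equal integrals over \<open>K\<close>, give equal integrals
  against any function of the norm, in particular the overlap volume. The conclusion is this
  proportionality, cross-multiplied.\<close>

lemma moment_convolution_ratio:
  fixes K :: "'a::euclidean_space set"
  assumes K: "symmetric_body K" and \<tau>: "\<tau> > 0"
    and ov: "\<And>x y. body_norm K x = body_norm K y \<Longrightarrow> overlap_volume K \<tau> x = overlap_volume K \<tau> y"
    and m: "even m"
  defines "S \<equiv> \<lambda>\<xi>. \<Sum>k\<le>m. real (m choose k) * \<tau> ^ (m - k) * moment K \<xi> k * moment K \<xi> (m - k)"
  assumes nz: "\<xi> \<noteq> 0" "\<eta> \<noteq> 0"
  shows "moment K \<eta> m * S \<xi> = moment K \<xi> m * S \<eta>"
proof -
  obtain e where e: "\<And>r. r \<ge> 0 \<Longrightarrow> body_norm K (r *\<^sub>R e) = r"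
    using body_norm_unit_vector[OF K] by blast
  \<comment> \<open>The overlap volume as a function of the norm alone, read off along the ray
    through \<open>e\<close>.\<close>
  define g where "g r = ennreal (overlap_volume K \<tau> (r *\<^sub>R e))" for r
  have g: "ennreal (overlap_volume K \<tau> x) = g (body_norm K x)" for x
    unfolding g_def using ov[OF e[OF body_norm_nonneg[OF K, of x]]] by simp
  have [measurable]: "g \<in> borel_measurable borel"
    unfolding g_def using borel_measurable_overlap_volume[OF K \<tau>] by measurable
  define p where "p c \<xi> x = ennreal c * ennreal ((x \<bullet> \<xi>) ^ m)" for c and \<xi> x :: 'a
  have [measurable]: "p c \<xi> \<in> borel_measurable borel" for c \<xi> unfolding p_def by measurable
  have hom: "p c \<xi> (r *\<^sub>R x) = ennreal (r ^ m) * p c \<xi> x" if "r > 0" for c \<xi> r x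
    using that by (simp add: p_def power_mult_distrib ennreal_mult' mult.left_commute)
  have onK: "(\<integral>\<^sup>+x. indicator K x * p c \<xi> x \<partial>lborel) = ennreal (c * moment K \<xi> m)" if "c \<ge> 0" for c \<xi>
  proof -
    have "(\<integral>\<^sup>+x. indicator K x * p c \<xi> x \<partial>lborel)
      = (\<integral>\<^sup>+x. ennreal c * (indicator K x * ennreal ((x \<bullet> \<xi>) ^ m)) \<partial>lborel)"
      by (simp add: p_def mult.left_commute)
    also have "\<dots> = ennreal c * ennreal (moment K \<xi> m)"
      using symmetric_bodyD(3)[OF K]
      by (subst nn_integral_cmult) (simp_all add: nn_integral_moment[OF symmetric_bodyD(1)[OF K] m])
    finally show ?thesis using that by (simp add: ennreal_mult')
  qed
  have S: "(\<integral>\<^sup>+x. g (body_norm K x) * p c \<xi> x \<partial>lborel) = ennreal (c * (\<tau> ^ DIM('a) * S \<xi>))" if "c \<ge> 0" for c \<xi>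
  proof -
    have "(\<integral>\<^sup>+x. g (body_norm K x) * p c \<xi> x \<partial>lborel)
      = (\<integral>\<^sup>+x. ennreal c * (ennreal (overlap_volume K \<tau> x) * ennreal ((x \<bullet> \<xi>) ^ m)) \<partial>lborel)"
      by (simp add: p_def mult.left_commute g)
    also have "\<dots> = ennreal c * ennreal (\<tau> ^ DIM('a) * S \<xi>)"
      using borel_measurable_overlap_volume[OF K \<tau>] unfolding S_def
      by (subst nn_integral_cmult) (simp_all add: nn_integral_overlap_volume_power[OF K \<tau> m])
    finally show ?thesis using that by (simp add: ennreal_mult')
  qed
  define a b where "a = moment K \<xi> m" and "b = moment K \<eta> m"
  have ab: "a > 0" "b > 0" unfolding a_def b_def using moment_pos[OF K m] nz by auto
  \<comment> \<open>Needed to return from \<open>ennreal\<close> to the reals. As \<open>m\<close>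
    is even, \<open>k\<close> and \<open>m - k\<close> have the same parity: odd moments vanish,
    even ones are positive.\<close>
  have S0: "S \<zeta> \<ge> 0" if "\<zeta> \<noteq> 0" for \<zeta>
    unfolding S_def
  proof (intro sum_nonneg)
    fix k assume "k \<in> {..m}"
    then have "moment K \<zeta> k * moment K \<zeta> (m - k) \<ge> 0"
      using moment_odd[OF K, of k \<zeta>] moment_pos[OF K _ that, of k] moment_pos[OF K _ that, of "m - k"] m
      by (cases "even k") simp_all
    then show "real (m choose k) * \<tau> ^ (m - k) * moment K \<zeta> k * moment K \<zeta> (m - k) \<ge> 0"
      using \<tau> by (simp add: mult.assoc)
  qed
  \<comment> \<open>The weights are crossed so that both densities have integral
    \<open>a * b\<close> over \<open>K\<close>.\<close>
  have "(\<integral>\<^sup>+x. g (body_norm K x) * p b \<xi> x \<partial>lborel) = (\<integral>\<^sup>+x. g (body_norm K x) * p a \<eta> x \<partial>lborel)"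
    using ab by (intro nn_integral_body_norm_homogeneous_eq[OF K _ _ _ hom hom])
      (auto simp: onK a_def b_def mult.commute)
  then have "ennreal (b * (\<tau> ^ DIM('a) * S \<xi>)) = ennreal (a * (\<tau> ^ DIM('a) * S \<eta>))"
    using ab by (simp add: S)
  then have "b * (\<tau> ^ DIM('a) * S \<xi>) = a * (\<tau> ^ DIM('a) * S \<eta>)"
    using ab \<tau> S0[OF nz(1)] S0[OF nz(2)] by (simp add: ennreal_inj)
  then show ?thesis using \<tau> by (simp add: a_def b_def mult.left_commute)
qed

text \<open>Strong induction. The extreme terms k = 0 and k = m of both sums contribute the same
  product to the cross-multiplied identity and cancel; the middle sum \<open>R\<close> involves only
  lower moments and is common to both directions.\<close>

lemma moments_eq_if_second_moments_eq:
  fixes K :: "'a::euclidean_space set"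
  assumes K: "symmetric_body K" and \<tau>: "\<tau> > 0"
    and ov: "\<And>x y. body_norm K x = body_norm K y \<Longrightarrow> overlap_volume K \<tau> x = overlap_volume K \<tau> y"
    and nz: "\<xi> \<noteq> 0" "\<eta> \<noteq> 0" and two: "moment K \<xi> 2 = moment K \<eta> 2"
  shows "moment K \<xi> m = moment K \<eta> m"
proof (induction m rule: less_induct)
  case (less m)
  consider "odd m" | "m = 0" | "m = 2" | "even m" "m > 2"
    by (cases "odd m"; cases "m = 0"; cases "m = 2") (auto elim!: evenE)
  then show ?case
  proof cases
    case 4
    define t where "t \<xi> k = real (m choose k) * \<tau> ^ (m - k) * moment K \<xi> k * moment K \<xi> (m - k)" for \<xi> k
    define R where "R = (\<Sum>k\<in>{1..<m}. t \<xi> k)"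
    have R': "R = (\<Sum>k\<in>{1..<m}. t \<eta> k)"
      unfolding R_def using less.IH by (intro sum.cong) (auto simp: t_def)
    have split: "(\<Sum>k\<le>m. t \<zeta> k) = (1 + \<tau> ^ m) * moment K \<zeta> 0 * moment K \<zeta> m + (\<Sum>k\<in>{1..<m}. t \<zeta> k)" for \<zeta>
    proof -
      have "{..m} = insert 0 (insert m {1..<m})" using 4 by auto
      then show ?thesis using 4 by (simp add: t_def algebra_simps)
    qed
    \<comment> \<open>The term k = 2 is strictly positive and, as m > 2, lies in the range. For m =
      2 only the vanishing term k = 1 would remain, which is why the second moment is
      prescribed.\<close>
    have "R > 0"
      unfolding R_def
    proof (rule sum_pos2)
      show "2 \<in> {1..<m}" using 4 by auto
      show "t \<xi> 2 > 0" using 4 \<tau> nz moment_pos[OF K _ nz(1)] by (auto simp: t_def intro!: mult_pos_pos)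
      show "t \<xi> k \<ge> 0" if "k \<in> {1..<m}" for k
        using 4 that \<tau> moment_pos[OF K _ nz(1), of k] moment_pos[OF K _ nz(1), of "m - k"] moment_odd[OF K, of k \<xi>]
        by (cases "even k") (auto simp: t_def)
    qed simp
    define a b where "a = moment K \<xi> m" and "b = moment K \<eta> m"
    have "moment K \<xi> 0 = moment K \<eta> 0" by (simp add: moment_def)
    moreover have "b * (\<Sum>k\<le>m. t \<xi> k) = a * (\<Sum>k\<le>m. t \<eta> k)"
      unfolding a_def b_def t_def using 4(1) nz by (intro moment_convolution_ratio[OF K \<tau> ov]) auto
    ultimately have "b * R = a * R"
      unfolding split R_def[symmetric] R'[symmetric] a_def[symmetric] b_def[symmetric]
      by (simp add: algebra_simps)
    with \<open>R > 0\<close> show ?thesis by (simp add: a_def b_def)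
  qed (use two moment_odd[OF K] in \<open>auto simp: moment_def\<close>)
qed

section \<open>From second moments to the ellipsoid\<close>

text \<open>The second moment is the diagonal of a symmetric bilinear form, the inertia form of
  \<open>K\<close>, which is positive definite because \<open>K\<close> contains a ball.\<close>

lemma second_moment_norm_representation:
  fixes K :: "'a::euclidean_space set"
  assumes K: "symmetric_body K"
  obtains L :: "'a \<Rightarrow> 'a" where "linear L" "inj L" "\<And>\<xi>. (norm (L \<xi>))\<^sup>2 = moment K \<xi> 2"
proof -
  define B where "B \<xi> \<eta> = (\<integral>x. indicat_real K x * ((x \<bullet> \<xi>) * (x \<bullet> \<eta>)) \<partial>lborel)" for \<xi> \<eta> :: 'a
  have int: "integrable lborel (\<lambda>x. indicat_real K x * ((x \<bullet> \<xi>) * (x \<bullet> \<eta>)))" for \<xi> \<eta> :: 'a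
    using borel_integrable_compact[OF symmetric_bodyD(1)[OF K], of "\<lambda>x. (x \<bullet> \<xi>) * (x \<bullet> \<eta>)"]
    by (simp add: continuous_intros)
  have sym: "B \<xi> \<eta> = B \<eta> \<xi>" for \<xi> \<eta> by (simp add: B_def mult.commute)
  have lin: "linear (B \<xi>)" for \<xi>
  proof (rule linearI)
    show "B \<xi> (\<eta> + \<zeta>) = B \<xi> \<eta> + B \<xi> \<zeta>" for \<eta> \<zeta>
      unfolding B_def using int by (simp add: inner_add_right distrib_left flip: Bochner_Integration.integral_add)
    show "B \<xi> (c *\<^sub>R \<eta>) = c *\<^sub>R B \<xi> \<eta>" for c \<eta>
      unfolding B_def by (simp add: mult.left_commute flip: integral_mult_right_zero)
  qed
  then have "linear (\<lambda>\<xi>. B \<xi> \<eta>)" for \<eta> unfolding sym[of _ \<eta>] .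
  with lin have bil: "bilinear B" by (simp add: bilinear_def)
  have diag: "B \<xi> \<xi> = moment K \<xi> 2" for \<xi> by (simp add: B_def moment_def power2_eq_square)
  show thesis
  proof (rule bilinear_form_norm_representation[OF bil sym])
    show "B \<xi> \<xi> > 0" if "\<xi> \<noteq> 0" for \<xi> unfolding diag using that by (intro moment_pos[OF K]) auto
  qed (use that diag in auto)
qed

text \<open>Each direction can be rescaled to have the second moment of one reference direction.
  Then all moments and the values of the support function agree, so the support function is a
  constant multiple of \<open>norm (L \<xi>)\<close>.\<close>

lemma overlap_volume_imp_ellipsoid:
  fixes K :: "'a::euclidean_space set"
  assumes K: "symmetric_body K" and \<tau>: "\<tau> > 0"
    and ov: "\<And>x y. body_norm K x = body_norm K y \<Longrightarrow> overlap_volume K \<tau> x = overlap_volume K \<tau> y"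
  shows "ellipsoid K"
proof -
  obtain L :: "'a \<Rightarrow> 'a" where L: "linear L" "inj L" "\<And>\<xi>. (norm (L \<xi>))\<^sup>2 = moment K \<xi> 2"
    using second_moment_norm_representation[OF K] by blast
  have L0: "norm (L \<xi>) > 0" if "\<xi> \<noteq> 0" for \<xi>
    using that L(1,2) linear_injective_0[of L] by auto
  obtain \<xi>\<^sub>0 :: 'a where "\<xi>\<^sub>0 \<in> Basis" using nonempty_Basis by blast
  then have nz: "\<xi>\<^sub>0 \<noteq> 0" by (rule nonzero_Basis)
  have ne: "K \<noteq> {}" using symmetric_body_zero_mem[OF K] by blast
  have cont: "continuous_on K (\<lambda>z. z \<bullet> \<zeta>)" for \<zeta> by (intro continuous_intros)
  obtain y where y: "y \<in> K" "\<And>z. z \<in> K \<Longrightarrow> z \<bullet> \<xi>\<^sub>0 \<le> y \<bullet> \<xi>\<^sub>0"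
    using continuous_attains_sup[OF symmetric_bodyD(1)[OF K] ne cont[of "\<xi>\<^sub>0"]] by blast
  \<comment> \<open>The ratio of the support function to \<open>norm (L \<xi>)\<close>, measured at
    the reference direction.\<close>
  define C where "C = y \<bullet> \<xi>\<^sub>0 / norm (L \<xi>\<^sub>0)"
  obtain e where e: "e > 0" "cball 0 e \<subseteq> K" using symmetric_body_contains_ball[OF K] .
  have "(e / norm \<xi>\<^sub>0) *\<^sub>R \<xi>\<^sub>0 \<in> K" using e nz by (auto simp: subset_iff)
  then have "((e / norm \<xi>\<^sub>0) *\<^sub>R \<xi>\<^sub>0) \<bullet> \<xi>\<^sub>0 \<le> y \<bullet> \<xi>\<^sub>0" by (rule y(2))
  moreover have "((e / norm \<xi>\<^sub>0) *\<^sub>R \<xi>\<^sub>0) \<bullet> \<xi>\<^sub>0 > 0" using e nz by simp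
  ultimately have "0 < y \<bullet> \<xi>\<^sub>0" by linarith
  then have C: "C > 0" using L0[OF nz] by (simp add: C_def)
  have key: "(\<forall>x\<in>K. x \<bullet> \<xi> \<le> C * norm (L \<xi>)) \<and> (\<exists>x\<in>K. x \<bullet> \<xi> = C * norm (L \<xi>))" for \<xi>
  proof (cases "\<xi> = 0")
    case True
    then show ?thesis using ne L(1) by (auto simp: linear_0)
  next
    case False
    \<comment> \<open>Chosen so that \<open>L (c *\<^sub>R \<xi>)\<close> has the same norm as
      \<open>L\<close> at the reference direction.\<close>
    define c where "c = norm (L \<xi>\<^sub>0) / norm (L \<xi>)"
    have c: "c > 0" using L0[OF nz] L0[OF False] by (simp add: c_def)
    have two: "moment K (c *\<^sub>R \<xi>) 2 = moment K \<xi>\<^sub>0 2"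
      unfolding moment_scaleR L(3)[symmetric] using L0[OF False] by (simp add: c_def power_divide)
    have c0: "c *\<^sub>R \<xi> \<noteq> 0" using c False by simp
    have eq: "moment K (c *\<^sub>R \<xi>) m = moment K \<xi>\<^sub>0 m" for m
      by (rule moments_eq_if_second_moments_eq[OF K \<tau> _ c0 nz two]) (rule ov)
    have CL: "C * norm (L \<xi>) = (y \<bullet> \<xi>\<^sub>0) / c" using L0[OF nz] L0[OF False] by (simp add: C_def c_def)
    have le: "x \<bullet> (c *\<^sub>R \<xi>) \<le> y \<bullet> \<xi>\<^sub>0" if "x \<in> K" for x
      by (rule support_le_if_moments_eq[OF K _ that]) (rule eq, rule y(2))
    obtain x where x: "x \<in> K" "\<And>z. z \<in> K \<Longrightarrow> z \<bullet> (c *\<^sub>R \<xi>) \<le> x \<bullet> (c *\<^sub>R \<xi>)"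
      using continuous_attains_sup[OF symmetric_bodyD(1)[OF K] ne cont[of "c *\<^sub>R \<xi>"]] by blast
    \<comment> \<open>Equality of moments is symmetric, so the comparison of maxima also runs in the
      other direction.\<close>
    have "y \<bullet> \<xi>\<^sub>0 \<le> x \<bullet> (c *\<^sub>R \<xi>)"
      by (rule support_le_if_moments_eq[OF K _ y(1)]) (rule eq[symmetric], rule x(2))
    with le[OF x(1)] have "x \<bullet> (c *\<^sub>R \<xi>) = y \<bullet> \<xi>\<^sub>0" by simp
    then have "x \<bullet> \<xi> = (y \<bullet> \<xi>\<^sub>0) / c" using c by (simp add: eq_divide_eq mult.commute)
    moreover have "z \<bullet> \<xi> \<le> (y \<bullet> \<xi>\<^sub>0) / c" if "z \<in> K" for z
      using le[OF that] c by (simp add: pos_le_divide_eq mult.commute)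
    ultimately show ?thesis unfolding CL using x(1) by blast
  qed
  show ?thesis
  proof (rule ellipsoid_if_support[of K "\<lambda>\<xi>. C *\<^sub>R L \<xi>"])
    show "linear (\<lambda>\<xi>. C *\<^sub>R L \<xi>)" using L(1) by (rule linear_compose_scale_right)
    show "inj (\<lambda>\<xi>. C *\<^sub>R L \<xi>)" using L(2) C by (auto simp: inj_def)
    show "x \<bullet> \<xi> \<le> norm (C *\<^sub>R L \<xi>)" if "x \<in> K" for x \<xi> using key[of \<xi>] that C by simp
    show "\<exists>x\<in>K. x \<bullet> \<xi> = norm (C *\<^sub>R L \<xi>)" for \<xi> using key[of \<xi>] C by simp
  qed (rule symmetric_bodyD[OF K])+
qed

theorem theorem1p1:
  fixes K :: "(real ^ 'n) set"
  assumes "symmetric_body K"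
  shows "(\<exists>\<tau>>0. \<forall>x y. body_norm K x = body_norm K y \<longrightarrow>
            overlap_volume K \<tau> x = overlap_volume K \<tau> y) \<longleftrightarrow> ellipsoid K"
proof
  assume "\<exists>\<tau>>0. \<forall>x y. body_norm K x = body_norm K y \<longrightarrow>
      overlap_volume K \<tau> x = overlap_volume K \<tau> y"
  then obtain \<tau> where "\<tau> > 0"
    "\<And>x y. body_norm K x = body_norm K y \<Longrightarrow> overlap_volume K \<tau> x = overlap_volume K \<tau> y"
    by blast
  then show "ellipsoid K" by (rule overlap_volume_imp_ellipsoid[OF assms])
next
  assume "ellipsoid K"
  then have "\<forall>x y. body_norm K x = body_norm K y \<longrightarrow> overlap_volume K 1 x = overlap_volume K 1 y"
    using ellipsoid_imp_overlap_volume[OF assms] by blast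
  then show "\<exists>\<tau>>0. \<forall>x y. body_norm K x = body_norm K y \<longrightarrow>
      overlap_volume K \<tau> x = overlap_volume K \<tau> y"
    using zero_less_one by blast
qed

end
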